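(* Let $\mathsf{A}\in\mathbb{R}^{J_1\times J_1\times\cdots\times J_N\times J_N}$ and $\mathsf{C}\in\mathbb{R}^{I_1\times J_1\times\cdots\times I_N\times J_N}$ be even-order paired tensors. The pair $(\mathsf{A},\mathsf{C})$ is observable on $[t_0,t_1]$ if and only if the observability Gramian $$\mathsf{W}_o(t_0,t_1)=\sum_{t=t_0}^{t_1-1}(\mathsf{A}^\top)^{t-t_0}*\mathsf{C}^\top*\mathsf{C}*\mathsf{A}^{t-t_0},$$ which is a weakly symmetric even-order square tensor, is U-positive definite.
   Context: An even-order paired tensor is a $2N$-th order real tensor with elements written in pairwise index notation, $\mathsf{M}_{p_1q_1\cdots p_Nq_N}$. Einstein products: for $\mathsf{M}\in\mathbb{R}^{P_1\times Q_1\times\cdots\times P_N\times Q_N}$ and $\mathsf{X}\in\mathbb{R}^{Q_1\times\cdots\times Q_N}$, $(\mathsf{M}*\mathsf{X})_{p_1\cdots p_N}=\sum_{q_1,\dots,q_N}\mathsf{M}_{p_1q_1\cdots p_Nq_N}\mathsf{X}_{q_1\cdots q_N}$; for $\mathsf{L}\in\mathbb{R}^{Q_1\times S_1\times\cdots\times Q_N\times S_N}$, $(\mathsf{M}*\mathsf{L})_{p_1s_1\cdots p_Ns_N}=\sum_{q_1,\dots,q_N}\mathsf{M}_{p_1q_1\cdots p_Nq_N}\mathsf{L}_{q_1s_1\cdots q_Ns_N}$. $\mathsf{A}^k$ is the $k$-fold Einstein product of $\mathsf{A}$ with itself, and $\mathsf{A}^0=\mathsf{I}$ is the identity tensor for $*$.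 The U-transpose is $(\mathsf{M}^\top)_{q_1p_1\cdots q_Np_N}=\mathsf{M}_{p_1q_1\cdots p_Nq_N}$; $\mathsf{M}$ is weakly symmetric if $\mathsf{M}^\top=\mathsf{M}$. An even-order square tensor $\mathsf{W}\in\mathbb{R}^{J_1\times J_1\times\cdots\times J_N\times J_N}$ is U-positive definite if $\mathsf{X}^\top*\mathsf{W}*\mathsf{X}=\sum_{j_1,\dots,j_N}\sum_{i_1,\dots,i_N}\mathsf{X}_{j_1\cdots j_N}\mathsf{W}_{j_1i_1\cdots j_Ni_N}\mathsf{X}_{i_1\cdots i_N}>0$ for every nonzero $\mathsf{X}\in\mathbb{R}^{J_1\times\cdots\times J_N}$. Time $t$ is discrete (integer-valued). The pair $(\mathsf{A},\mathsf{C})$ is observable on $[t_0,t_1]$ if, for the system $\mathsf{X}_{t+1}=\mathsf{A}*\mathsf{X}_t$, $\mathsf{Y}_t=\mathsf{C}*\mathsf{X}_t$ with states $\mathsf{X}_t\in\mathbb{R}^{J_1\times\cdots\times J_N}$ and outputs $\mathsf{Y}_t\in\mathbb{R}^{I_1\times\cdots\times I_N}$, any initial state $\mathsf{X}_{t_0}=\mathsf{X}_0$ can be uniquely determined by $\mathsf{Y}_t$ on $[t_0,t_1]$, that is, by the outputs $\mathsf{Y}_t$ for $t\in[t_0,t_1]$.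
   Formalization: Observability on [t0,t1] is taken to use only the outputs Y_t for t0 ≤ t ≤ t1−1, matching the Gramian's summation range; with Y_{t1} included the equivalence fails (e.g. A swapping two coordinates, C reading the first, t1 = t0+1). *)

theory Defs
  imports Complex_Main "HOL-Library.FuncSet"
begin

text \<open>
  A tensor of order N and size J_1 x ... x J_N is a real function on multi-indices, the dimensions
  being given by a list J with \<^term>\<open>length J = N\<close>; indices run from 0.  Tensors are extensional, so
  that equality of tensors is equality of functions.
\<close>

definition indices :: "nat list \<Rightarrow> nat list set" where
  "indices J = listset (map (\<lambda>n. {..<n}) J)"

definition tensors :: "nat list \<Rightarrow> (nat list \<Rightarrow> real) set" where
  "tensors J = indices J \<rightarrow>\<^sub>E UNIV"

definition zero_tensor :: "nat list \<Rightarrow> nat list \<Rightarrow> real" where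
  "zero_tensor J = (\<lambda>j\<in>indices J. 0)"

text \<open>
  In an even-order paired tensor of size P_1 x Q_1 x ... x P_N x Q_N the index
  p_1 q_1 ... p_N q_N is the list of pairs [(p_1, q_1), ..., (p_N, q_N)], that is, \<^term>\<open>zip p q\<close>.
  The size lists P and Q are meant to have the same length N.
\<close>

definition paired_indices :: "nat list \<Rightarrow> nat list \<Rightarrow> (nat \<times> nat) list set" where
  "paired_indices P Q = listset (map2 (\<lambda>m n. {..<m} \<times> {..<n}) P Q)"

definition paired_tensors :: "nat list \<Rightarrow> nat list \<Rightarrow> ((nat \<times> nat) list \<Rightarrow> real) set" where
  "paired_tensors P Q = paired_indices P Q \<rightarrow>\<^sub>E UNIV"

definition einstein_apply ::
  "nat list \<Rightarrow> nat list \<Rightarrow> ((nat \<times> nat) list \<Rightarrow> real) \<Rightarrow> (nat list \<Rightarrow> real) \<Rightarrow> nat list \<Rightarrow> real" where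
  "einstein_apply P Q M X = (\<lambda>p\<in>indices P. \<Sum>q\<in>indices Q. M (zip p q) * X q)"

definition einstein_mult ::
  "nat list \<Rightarrow> nat list \<Rightarrow> nat list \<Rightarrow> ((nat \<times> nat) list \<Rightarrow> real) \<Rightarrow> ((nat \<times> nat) list \<Rightarrow> real)
    \<Rightarrow> (nat \<times> nat) list \<Rightarrow> real" where
  "einstein_mult P Q S M L =
     (\<lambda>ps\<in>paired_indices P S. \<Sum>q\<in>indices Q. M (zip (map fst ps) q) * L (zip q (map snd ps)))"

definition identity_tensor :: "nat list \<Rightarrow> (nat \<times> nat) list \<Rightarrow> real" where
  "identity_tensor J = (\<lambda>ji\<in>paired_indices J J. if map fst ji = map snd ji then 1 else 0)"

primrec einstein_power ::
  "nat list \<Rightarrow> ((nat \<times> nat) list \<Rightarrow> real) \<Rightarrow> nat \<Rightarrow> (nat \<times> nat) list \<Rightarrow> real" where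
  "einstein_power J A 0 = identity_tensor J"
| "einstein_power J A (Suc k) = einstein_mult J J J A (einstein_power J A k)"

text \<open>The U-transpose of a tensor in \<^term>\<open>paired_tensors P Q\<close>; it lies in \<^term>\<open>paired_tensors Q P\<close>.\<close>

definition u_transpose ::
  "nat list \<Rightarrow> nat list \<Rightarrow> ((nat \<times> nat) list \<Rightarrow> real) \<Rightarrow> (nat \<times> nat) list \<Rightarrow> real" where
  "u_transpose P Q M = (\<lambda>qp\<in>paired_indices Q P. M (map prod.swap qp))"

definition weakly_symmetric :: "nat list \<Rightarrow> ((nat \<times> nat) list \<Rightarrow> real) \<Rightarrow> bool" where
  "weakly_symmetric J M \<longleftrightarrow> u_transpose J J M = M"

definition u_positive_definite :: "nat list \<Rightarrow> ((nat \<times> nat) list \<Rightarrow> real) \<Rightarrow> bool" where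
  "u_positive_definite J W \<longleftrightarrow>
     (\<forall>X\<in>tensors J. X \<noteq> zero_tensor J \<longrightarrow>
        (\<Sum>j\<in>indices J. \<Sum>i\<in>indices J. X j * W (zip j i) * X i) > 0)"

definition state_trajectory ::
  "nat list \<Rightarrow> ((nat \<times> nat) list \<Rightarrow> real) \<Rightarrow> int \<Rightarrow> (int \<Rightarrow> nat list \<Rightarrow> real) \<Rightarrow> bool" where
  "state_trajectory J A t\<^sub>0 X \<longleftrightarrow>
     (\<forall>t\<ge>t\<^sub>0. X t \<in> tensors J \<and> X (t + 1) = einstein_apply J J A (X t))"

text \<open>
  Observability from the outputs at the times in T: the initial state is uniquely determined by
  them.  The time window [t0, t1] of a discrete-time system is taken here as
  \<^term>\<open>T = {t0..<t1 :: int}\<close>, the usual convention for discrete-time systems, which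
  matches the upper limit t1 - 1 of the Gramian.  With the output at time t1 included, the Gramian
  criterion fails: for N = 1, J = [2], I = [1], t1 = t0 + 1, with A exchanging the two coordinates
  and C reading the first one, the outputs at t0 and t1 are the two coordinates of the initial
  state, but the Gramian is \<open>C\<^sup>T * C\<close>, which is singular.  Since t1 is arbitrary, the closed
  window from t0 to t1 is \<^term>\<open>{t0..<t1 + 1 :: int}\<close>, and belongs to the Gramian with upper limit t1.
\<close>

definition observable ::
  "nat list \<Rightarrow> nat list \<Rightarrow> ((nat \<times> nat) list \<Rightarrow> real) \<Rightarrow> ((nat \<times> nat) list \<Rightarrow> real)
    \<Rightarrow> int \<Rightarrow> int set \<Rightarrow> bool" where
  "observable I J A C t\<^sub>0 T \<longleftrightarrow>
     (\<forall>X X'. state_trajectory J A t\<^sub>0 X \<longrightarrow> state_trajectory J A t\<^sub>0 X' \<longrightarrow>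
        (\<forall>t\<in>T. einstein_apply I J C (X t) = einstein_apply I J C (X' t)) \<longrightarrow> X t\<^sub>0 = X' t\<^sub>0)"

definition observability_gramian ::
  "nat list \<Rightarrow> nat list \<Rightarrow> ((nat \<times> nat) list \<Rightarrow> real) \<Rightarrow> ((nat \<times> nat) list \<Rightarrow> real)
    \<Rightarrow> int \<Rightarrow> int \<Rightarrow> (nat \<times> nat) list \<Rightarrow> real" where
  "observability_gramian I J A C t\<^sub>0 t\<^sub>1 =
     (\<lambda>ji\<in>paired_indices J J. \<Sum>t = t\<^sub>0..t\<^sub>1 - 1.
        einstein_mult J J J
          (einstein_mult J I J
            (einstein_mult J J I (einstein_power J (u_transpose J J A) (nat (t - t\<^sub>0)))
              (u_transpose I J C))
            C)
          (einstein_power J A (nat (t - t\<^sub>0))) ji)"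

end

theory Submission
  imports Defs
begin

text \<open>
  Write \<open>G\<^sub>k = C * A\<^sup>k\<close>.  The state at time \<open>t\<^sub>0 + k\<close> is \<open>A\<^sup>k * X\<^sub>0\<close>, so by linearity observability says
  that \<open>X = 0\<close> is the only state with \<open>G\<^sub>k * X = 0\<close> for all \<open>k\<close> in the window.  Since
  \<open>(A\<^sup>T)\<^sup>k = (A\<^sup>k)\<^sup>T\<close>, the Gramian is the sum of the \<open>G\<^sub>k\<^sup>T * G\<^sub>k\<close>, and its quadratic form at \<open>X\<close> is
  the sum of the squared norms of the \<open>G\<^sub>k * X\<close>, which vanishes exactly when all of them do.
\<close>

lemma mem_listset_iff: "xs \<in> listset As \<longleftrightarrow> list_all2 (\<in>) xs As"
proof (induction As arbitrary: xs)
  case (Cons B As)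
  then show ?case by (cases xs) (auto simp: set_Cons_def)
qed simp

lemma finite_indices: "finite (indices J)"
proof -
  have "finite (listset As)" if "\<forall>B\<in>set As. finite B" for As :: "nat set list"
    using that
  proof (induction As)
    case (Cons B As)
    have "set_Cons B (listset As) = (\<lambda>(x, xs). x # xs) ` (B \<times> listset As)"
      by (auto simp: set_Cons_def)
    with Cons show ?case by simp
  qed simp
  then show ?thesis by (simp add: indices_def)
qed

lemma length_indices: "j \<in> indices J \<Longrightarrow> length j = length J"
  by (auto simp: indices_def mem_listset_iff dest: list_all2_lengthD)

lemma zip_in_paired_indices:
  assumes "p \<in> indices P" "q \<in> indices Q"
  shows "zip p q \<in> paired_indices P Q"
  using assms length_indices[OF assms(1)] length_indices[OF assms(2)]
  unfolding indices_def paired_indices_def mem_listset_iff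
  by (auto simp: list_all2_conv_all_nth)

lemma paired_indicesE:
  assumes "ps \<in> paired_indices P Q" "length P = length Q"
  obtains p q where "p \<in> indices P" "q \<in> indices Q" "ps = zip p q"
proof (rule that)
  have len: "length ps = length P"
    and nth: "\<And>n. n < length ps \<Longrightarrow> ps ! n \<in> {..<P ! n} \<times> {..<Q ! n}"
    using assms unfolding paired_indices_def mem_listset_iff
    by (auto simp: list_all2_conv_all_nth)
  show "map fst ps \<in> indices P" "map snd ps \<in> indices Q"
    using len nth assms(2) unfolding indices_def mem_listset_iff
    by (auto simp: list_all2_conv_all_nth mem_Times_iff)
  show "ps = zip (map fst ps) (map snd ps)"
    by (simp add: zip_map_fst_snd)
qed

lemma paired_tensors_eqI:
  assumes "M \<in> paired_tensors P Q" "L \<in> paired_tensors P Q" "length P = length Q"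
    and "\<And>p q. p \<in> indices P \<Longrightarrow> q \<in> indices Q \<Longrightarrow> M (zip p q) = L (zip p q)"
  shows "M = L"
  using assms(1,2) unfolding paired_tensors_def
  by (rule PiE_ext) (metis assms(3,4) paired_indicesE)

lemma tensors_eqI:
  assumes "X \<in> tensors J" "Y \<in> tensors J" "\<And>j. j \<in> indices J \<Longrightarrow> X j = Y j"
  shows "X = Y"
  using assms unfolding tensors_def by (rule PiE_ext)

lemma zero_tensor_in_tensors [simp]: "zero_tensor J \<in> tensors J"
  by (simp add: zero_tensor_def tensors_def)

lemma einstein_apply_in_tensors [simp]: "einstein_apply P Q M X \<in> tensors P"
  by (simp add: einstein_apply_def tensors_def)

lemma einstein_mult_in_paired_tensors [simp]: "einstein_mult P Q S M L \<in> paired_tensors P S"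
  by (simp add: einstein_mult_def paired_tensors_def)

lemma identity_tensor_in_paired_tensors [simp]: "identity_tensor J \<in> paired_tensors J J"
  by (simp add: identity_tensor_def paired_tensors_def)

lemma u_transpose_in_paired_tensors [simp]: "u_transpose P Q M \<in> paired_tensors Q P"
  by (simp add: u_transpose_def paired_tensors_def)

lemma einstein_power_in_paired_tensors [simp]: "einstein_power J A k \<in> paired_tensors J J"
  by (cases k) simp_all

lemma einstein_mult_zip:
  assumes "length P = length S" "p \<in> indices P" "s \<in> indices S"
  shows "einstein_mult P Q S M L (zip p s) = (\<Sum>q\<in>indices Q. M (zip p q) * L (zip q s))"
  using assms by (simp add: einstein_mult_def zip_in_paired_indices length_indices)

lemma identity_tensor_zip:
  assumes "j \<in> indices J" "i \<in> indices J"
  shows "identity_tensor J (zip j i) = (if j = i then 1 else 0)"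
  using assms by (simp add: identity_tensor_def zip_in_paired_indices length_indices del: map_eq_conv)

lemma u_transpose_zip:
  assumes "p \<in> indices P" "q \<in> indices Q" "length P = length Q"
  shows "u_transpose P Q M (zip q p) = M (zip p q)"
proof -
  have "map prod.swap (zip q p) = zip p q"
    using assms by (simp add: zip_commute[of p q] prod.swap_def case_prod_beta')
  with assms show ?thesis
    by (simp add: u_transpose_def zip_in_paired_indices)
qed

lemma einstein_mult_assoc:
  assumes "length P = length Q" "length Q = length R" "length R = length S"
  shows "einstein_mult P R S (einstein_mult P Q R M L) K
    = einstein_mult P Q S M (einstein_mult Q R S L K)" (is "?l = ?r")
proof (rule paired_tensors_eqI)
  fix p s assume ps: "p \<in> indices P" "s \<in> indices S"
  have "?l (zip p s)
      = (\<Sum>r\<in>indices R. \<Sum>q\<in>indices Q. M (zip p q) * L (zip q r) * K (zip r s))"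
    using ps assms by (simp add: einstein_mult_zip sum_distrib_right)
  also have "\<dots> = (\<Sum>q\<in>indices Q. \<Sum>r\<in>indices R. M (zip p q) * L (zip q r) * K (zip r s))"
    by (rule sum.swap)
  also have "\<dots> = ?r (zip p s)"
    using ps assms by (simp add: einstein_mult_zip sum_distrib_left mult.assoc)
  finally show "?l (zip p s) = ?r (zip p s)" .
qed (use assms in simp_all)

lemma einstein_mult_identity_left:
  assumes "M \<in> paired_tensors P Q" "length P = length Q"
  shows "einstein_mult P P Q (identity_tensor P) M = M"
  using assms
  by (intro paired_tensors_eqI[of _ P Q])
    (simp_all add: einstein_mult_zip identity_tensor_zip finite_indices
      if_distrib[of "\<lambda>x. x * _"] sum.delta' cong: if_cong)

lemma einstein_mult_identity_right:
  assumes "M \<in> paired_tensors P Q" "length P = length Q"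
  shows "einstein_mult P Q Q M (identity_tensor Q) = M"
  using assms
  by (intro paired_tensors_eqI[of _ P Q])
    (simp_all add: einstein_mult_zip identity_tensor_zip finite_indices
      if_distrib[of "\<lambda>x. _ * x"] sum.delta cong: if_cong)

lemma einstein_apply_mult:
  assumes "length P = length Q" "length Q = length R"
  shows "einstein_apply P R (einstein_mult P Q R M L) X
    = einstein_apply P Q M (einstein_apply Q R L X)" (is "?l = ?r")
proof (rule tensors_eqI)
  fix p assume p: "p \<in> indices P"
  have "?l p = (\<Sum>r\<in>indices R. \<Sum>q\<in>indices Q. M (zip p q) * L (zip q r) * X r)"
    using p assms by (simp add: einstein_apply_def einstein_mult_zip sum_distrib_right)
  also have "\<dots> = (\<Sum>q\<in>indices Q. \<Sum>r\<in>indices R. M (zip p q) * L (zip q r) * X r)"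
    by (rule sum.swap)
  also have "\<dots> = ?r p"
    using p by (simp add: einstein_apply_def sum_distrib_left mult.assoc)
  finally show "?l p = ?r p" .
qed simp_all

lemma einstein_apply_identity:
  assumes "X \<in> tensors J"
  shows "einstein_apply J J (identity_tensor J) X = X"
  using einstein_apply_in_tensors assms
  by (rule tensors_eqI)
    (simp add: einstein_apply_def identity_tensor_zip finite_indices
      if_distrib[of "\<lambda>x. x * _"] sum.delta' cong: if_cong)

lemma einstein_apply_zero: "einstein_apply P Q M (zero_tensor Q) = zero_tensor P"
  by (auto simp: einstein_apply_def zero_tensor_def)

lemma einstein_apply_diff_eq_zero_iff:
  "einstein_apply P Q M (\<lambda>q\<in>indices Q. X q - Y q) = zero_tensor P
    \<longleftrightarrow> einstein_apply P Q M X = einstein_apply P Q M Y"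
  by (auto simp: einstein_apply_def zero_tensor_def fun_eq_iff restrict_def
      right_diff_distrib sum_subtractf)

lemma u_transpose_mult:
  assumes "length P = length Q" "length Q = length S"
  shows "u_transpose P S (einstein_mult P Q S M L)
    = einstein_mult S Q P (u_transpose Q S L) (u_transpose P Q M)"
  using assms
  by (intro paired_tensors_eqI[of _ S P])
    (simp_all add: u_transpose_zip einstein_mult_zip mult.commute)

lemma u_transpose_u_transpose:
  assumes "M \<in> paired_tensors P Q" "length P = length Q"
  shows "u_transpose Q P (u_transpose P Q M) = M"
  using assms by (intro paired_tensors_eqI[of _ P Q]) (simp_all add: u_transpose_zip)

lemma u_transpose_identity: "u_transpose J J (identity_tensor J) = identity_tensor J"
  by (intro paired_tensors_eqI[of _ J J]) (auto simp: u_transpose_zip identity_tensor_zip)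

lemma einstein_power_Suc_right:
  assumes "A \<in> paired_tensors J J"
  shows "einstein_power J A (Suc k) = einstein_mult J J J (einstein_power J A k) A"
proof (induction k)
  case 0
  show ?case
    using assms by (simp add: einstein_mult_identity_left einstein_mult_identity_right)
next
  case (Suc k)
  have "einstein_power J A (Suc (Suc k))
      = einstein_mult J J J A (einstein_mult J J J (einstein_power J A k) A)"
    unfolding Suc[symmetric] by simp
  also have "\<dots> = einstein_mult J J J (einstein_power J A (Suc k)) A"
    by (simp add: einstein_mult_assoc)
  finally show ?case .
qed

lemma einstein_power_u_transpose:
  assumes "A \<in> paired_tensors J J"
  shows "einstein_power J (u_transpose J J A) k = u_transpose J J (einstein_power J A k)"
proof (induction k)
  case 0
  show ?case by (simp add: u_transpose_identity)
next
  case (Suc k)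
  have "u_transpose J J (einstein_power J A (Suc k))
      = einstein_mult J J J (u_transpose J J A) (u_transpose J J (einstein_power J A k))"
    unfolding einstein_power_Suc_right[OF assms] by (simp add: u_transpose_mult)
  with Suc show ?case by simp
qed

lemma quadratic_form_normal_tensor:
  assumes "length I = length J"
  shows "(\<Sum>j\<in>indices J. \<Sum>i\<in>indices J.
      X j * einstein_mult J I J (u_transpose I J G) G (zip j i) * X i)
    = (\<Sum>p\<in>indices I. (einstein_apply I J G X p)\<^sup>2)"
proof -
  let ?s = "\<lambda>j i p. (G (zip p j) * X j) * (G (zip p i) * X i)"
  have "(\<Sum>j\<in>indices J. \<Sum>i\<in>indices J.
      X j * einstein_mult J I J (u_transpose I J G) G (zip j i) * X i)
    = (\<Sum>j\<in>indices J. \<Sum>i\<in>indices J. \<Sum>p\<in>indices I. ?s j i p)"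
    using assms
    by (intro sum.cong)
      (simp_all add: einstein_mult_zip u_transpose_zip sum_distrib_left sum_distrib_right ac_simps)
  also have "\<dots> = (\<Sum>j\<in>indices J. \<Sum>p\<in>indices I. \<Sum>i\<in>indices J. ?s j i p)"
    by (intro sum.cong refl sum.swap)
  also have "\<dots> = (\<Sum>p\<in>indices I. \<Sum>j\<in>indices J. \<Sum>i\<in>indices J. ?s j i p)"
    by (rule sum.swap)
  also have "\<dots> = (\<Sum>p\<in>indices I. (einstein_apply I J G X p)\<^sup>2)"
    by (simp add: einstein_apply_def power2_eq_square sum_product)
  finally show ?thesis .
qed

lemma weakly_symmetric_normal_tensor:
  assumes "length I = length J" "G \<in> paired_tensors I J"
  shows "weakly_symmetric J (einstein_mult J I J (u_transpose I J G) G)"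
  using assms by (simp add: weakly_symmetric_def u_transpose_mult u_transpose_u_transpose)

lemma weakly_symmetric_sum:
  assumes "\<And>k. k \<in> K \<Longrightarrow> weakly_symmetric J (M k)"
  shows "weakly_symmetric J (\<lambda>ji\<in>paired_indices J J. \<Sum>k\<in>K. M k ji)"
  unfolding weakly_symmetric_def
proof (rule paired_tensors_eqI)
  fix j i assume ji: "j \<in> indices J" "i \<in> indices J"
  have "M k (zip i j) = M k (zip j i)" if "k \<in> K" for k
    using assms[OF that] ji unfolding weakly_symmetric_def by (metis u_transpose_zip)
  with ji show "u_transpose J J (\<lambda>ji\<in>paired_indices J J. \<Sum>k\<in>K. M k ji) (zip j i)
      = (\<lambda>ji\<in>paired_indices J J. \<Sum>k\<in>K. M k ji) (zip j i)"
    by (simp add: u_transpose_zip zip_in_paired_indices)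
qed (simp, simp add: paired_tensors_def, simp)

definition output_tensor ::
  "nat list \<Rightarrow> nat list \<Rightarrow> ((nat \<times> nat) list \<Rightarrow> real) \<Rightarrow> ((nat \<times> nat) list \<Rightarrow> real)
    \<Rightarrow> nat \<Rightarrow> (nat \<times> nat) list \<Rightarrow> real" where
  "output_tensor I J A C k = einstein_mult I J J C (einstein_power J A k)"

lemma observability_gramian_eq_sum_normal:
  assumes "length I = length J" "A \<in> paired_tensors J J"
  shows "observability_gramian I J A C t\<^sub>0 t\<^sub>1 = (\<lambda>ji\<in>paired_indices J J. \<Sum>t = t\<^sub>0..t\<^sub>1 - 1.
    einstein_mult J I J (u_transpose I J (output_tensor I J A C (nat (t - t\<^sub>0))))
      (output_tensor I J A C (nat (t - t\<^sub>0))) ji)"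
  using assms
  by (simp add: observability_gramian_def output_tensor_def einstein_power_u_transpose
      u_transpose_mult einstein_mult_assoc)

lemma quadratic_form_observability_gramian:
  assumes "length I = length J" "A \<in> paired_tensors J J"
  shows "(\<Sum>j\<in>indices J. \<Sum>i\<in>indices J. X j * observability_gramian I J A C t\<^sub>0 t\<^sub>1 (zip j i) * X i)
    = (\<Sum>t\<in>{t\<^sub>0..<t\<^sub>1}. \<Sum>p\<in>indices I.
        (einstein_apply I J (output_tensor I J A C (nat (t - t\<^sub>0))) X p)\<^sup>2)"
proof -
  define N where "N t = einstein_mult J I J
    (u_transpose I J (output_tensor I J A C (nat (t - t\<^sub>0))))
    (output_tensor I J A C (nat (t - t\<^sub>0)))" for t
  have T: "{t\<^sub>0..t\<^sub>1 - 1} = {t\<^sub>0..<t\<^sub>1}" by auto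
  have "(\<Sum>j\<in>indices J. \<Sum>i\<in>indices J. X j * observability_gramian I J A C t\<^sub>0 t\<^sub>1 (zip j i) * X i)
      = (\<Sum>j\<in>indices J. \<Sum>i\<in>indices J. \<Sum>t\<in>{t\<^sub>0..<t\<^sub>1}. X j * N t (zip j i) * X i)"
    using assms
    by (simp add: observability_gramian_eq_sum_normal zip_in_paired_indices T N_def
        sum_distrib_left sum_distrib_right)
  also have "\<dots> = (\<Sum>j\<in>indices J. \<Sum>t\<in>{t\<^sub>0..<t\<^sub>1}. \<Sum>i\<in>indices J. X j * N t (zip j i) * X i)"
    by (intro sum.cong refl sum.swap)
  also have "\<dots> = (\<Sum>t\<in>{t\<^sub>0..<t\<^sub>1}. \<Sum>j\<in>indices J. \<Sum>i\<in>indices J. X j * N t (zip j i) * X i)"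
    by (rule sum.swap)
  finally show ?thesis
    using assms by (simp add: N_def quadratic_form_normal_tensor)
qed

lemma u_positive_definite_observability_gramian_iff:
  assumes "length I = length J" "A \<in> paired_tensors J J"
  shows "u_positive_definite J (observability_gramian I J A C t\<^sub>0 t\<^sub>1) \<longleftrightarrow>
    (\<forall>X\<in>tensors J. (\<forall>t\<in>{t\<^sub>0..<t\<^sub>1}.
        einstein_apply I J (output_tensor I J A C (nat (t - t\<^sub>0))) X = zero_tensor I)
      \<longrightarrow> X = zero_tensor J)"
proof -
  define S where "S X = (\<Sum>t\<in>{t\<^sub>0..<t\<^sub>1}. \<Sum>p\<in>indices I.
    (einstein_apply I J (output_tensor I J A C (nat (t - t\<^sub>0))) X p)\<^sup>2)" for X
  have "S X = 0 \<longleftrightarrow> (\<forall>t\<in>{t\<^sub>0..<t\<^sub>1}. \<forall>p\<in>indices I.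
      einstein_apply I J (output_tensor I J A C (nat (t - t\<^sub>0))) X p = 0)" for X
    unfolding S_def by (simp add: sum_nonneg_eq_0_iff sum_nonneg finite_indices)
  moreover have "einstein_apply I J G X = zero_tensor I
      \<longleftrightarrow> (\<forall>p\<in>indices I. einstein_apply I J G X p = 0)" for G X
    by (auto simp: zero_tensor_def einstein_apply_def fun_eq_iff)
  moreover have "S X \<ge> 0" for X
    unfolding S_def by (intro sum_nonneg) simp
  ultimately show ?thesis
    unfolding u_positive_definite_def quadratic_form_observability_gramian[OF assms]
      S_def[symmetric] by (metis order_less_le)
qed

lemma state_trajectory_eq_power:
  assumes "state_trajectory J A t\<^sub>0 X" "t\<^sub>0 \<le> t"
  shows "X t = einstein_apply J J (einstein_power J A (nat (t - t\<^sub>0))) (X t\<^sub>0)"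
  using assms(2)
proof (induction t rule: int_ge_induct)
  case base
  from assms show ?case by (simp add: state_trajectory_def einstein_apply_identity)
next
  case (step t)
  then have "nat (t + 1 - t\<^sub>0) = Suc (nat (t - t\<^sub>0))" by simp
  with step assms(1) show ?case
    by (simp add: state_trajectory_def einstein_apply_mult)
qed

lemma state_trajectory_power:
  assumes "X\<^sub>0 \<in> tensors J"
  shows "state_trajectory J A t\<^sub>0 (\<lambda>t. einstein_apply J J (einstein_power J A (nat (t - t\<^sub>0))) X\<^sub>0)"
proof -
  have "nat (t + 1 - t\<^sub>0) = Suc (nat (t - t\<^sub>0))" if "t\<^sub>0 \<le> t" for t
    using that by simp
  then show ?thesis
    by (simp add: state_trajectory_def einstein_apply_mult)
qed

lemma observable_iff:
  assumes "length I = length J" "T \<subseteq> {t\<^sub>0..}"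
  shows "observable I J A C t\<^sub>0 T \<longleftrightarrow>
    (\<forall>X\<in>tensors J. (\<forall>t\<in>T.
        einstein_apply I J (output_tensor I J A C (nat (t - t\<^sub>0))) X = zero_tensor I)
      \<longrightarrow> X = zero_tensor J)" (is "_ \<longleftrightarrow> ?kernel_trivial")
proof
  let ?G = "\<lambda>t. output_tensor I J A C (nat (t - t\<^sub>0))"
  let ?traj = "\<lambda>X t. einstein_apply J J (einstein_power J A (nat (t - t\<^sub>0))) X"
  have out: "einstein_apply I J C (?traj X t) = einstein_apply I J (?G t) X" for X t
    using assms by (simp add: output_tensor_def einstein_apply_mult)
  {
    assume obs: "observable I J A C t\<^sub>0 T"
    show ?kernel_trivial
    proof (intro ballI impI)
      fix X assume X: "X \<in> tensors J"
        and ker: "\<forall>t\<in>T. einstein_apply I J (?G t) X = zero_tensor I"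
      have "?traj X t\<^sub>0 = ?traj (zero_tensor J) t\<^sub>0"
        using obs[unfolded observable_def, rule_format,
            OF state_trajectory_power[OF X] state_trajectory_power[OF zero_tensor_in_tensors]]
          ker by (simp add: out einstein_apply_zero)
      with X show "X = zero_tensor J" by (simp add: einstein_apply_identity)
    qed
  next
    assume ker: ?kernel_trivial
    show "observable I J A C t\<^sub>0 T"
      unfolding observable_def
    proof (intro allI impI)
      fix X X'
      assume traj: "state_trajectory J A t\<^sub>0 X" "state_trajectory J A t\<^sub>0 X'"
        and eq: "\<forall>t\<in>T. einstein_apply I J C (X t) = einstein_apply I J C (X' t)"
      define D where "D = (\<lambda>j\<in>indices J. X t\<^sub>0 j - X' t\<^sub>0 j)"
      have "einstein_apply I J (?G t) D = zero_tensor I" if "t \<in> T" for t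
      proof -
        have "t\<^sub>0 \<le> t" using that assms(2) by auto
        then have "einstein_apply I J (?G t) (X t\<^sub>0) = einstein_apply I J (?G t) (X' t\<^sub>0)"
          using eq that traj by (metis state_trajectory_eq_power out)
        then show ?thesis by (simp add: D_def einstein_apply_diff_eq_zero_iff)
      qed
      moreover have "D \<in> tensors J" by (simp add: D_def tensors_def)
      ultimately have D: "D = zero_tensor J" using ker by blast
      show "X t\<^sub>0 = X' t\<^sub>0"
      proof (rule tensors_eqI)
        show "X t\<^sub>0 \<in> tensors J" "X' t\<^sub>0 \<in> tensors J"
          using traj by (auto simp: state_trajectory_def)
        show "X t\<^sub>0 j = X' t\<^sub>0 j" if "j \<in> indices J" for j
          using fun_cong[OF D, of j] that by (simp add: D_def zero_tensor_def)
      qed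
    qed
  }
qed

theorem theorem5p14:
  fixes I J :: "nat list" and A C :: "(nat \<times> nat) list \<Rightarrow> real" and t\<^sub>0 t\<^sub>1 :: int
  assumes "length I = length J"
    and "A \<in> paired_tensors J J"
    and "C \<in> paired_tensors I J"
  shows "observability_gramian I J A C t\<^sub>0 t\<^sub>1 \<in> paired_tensors J J
    \<and> weakly_symmetric J (observability_gramian I J A C t\<^sub>0 t\<^sub>1)
    \<and> (observable I J A C t\<^sub>0 {t\<^sub>0..<t\<^sub>1}
          \<longleftrightarrow> u_positive_definite J (observability_gramian I J A C t\<^sub>0 t\<^sub>1))"
proof (intro conjI)
  show "observability_gramian I J A C t\<^sub>0 t\<^sub>1 \<in> paired_tensors J J"
    by (simp add: observability_gramian_def paired_tensors_def)
  show "weakly_symmetric J (observability_gramian I J A C t\<^sub>0 t\<^sub>1)"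
    unfolding observability_gramian_eq_sum_normal[OF assms(1,2)]
    by (intro weakly_symmetric_sum weakly_symmetric_normal_tensor assms(1))
      (simp add: output_tensor_def)
  show "observable I J A C t\<^sub>0 {t\<^sub>0..<t\<^sub>1}
      \<longleftrightarrow> u_positive_definite J (observability_gramian I J A C t\<^sub>0 t\<^sub>1)"
    unfolding u_positive_definite_observability_gramian_iff[OF assms(1,2)]
    by (rule observable_iff) (use assms(1) in auto)
qed

end
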